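(* Let $w\ge1$ and let $x$ be a $w$-bit word whose bits $x_0$ (least significant), $x_1,\dots,x_{w-1}$ are regarded as Boolean variables. For $0\le b<w$, let $z_b$ be bit $b$ of $3x \bmod 2^w$, viewed as a Boolean function of $x_0,\dots,x_{w-1}$. Then the number of monomials in the algebraic normal form of $z_b$ is \[ (2+[\,b\text{ odd}\,])\cdot 2^{\lfloor b/2\rfloor}-1 . \]
   Context: $[P]$ is $1$ if the condition $P$ holds and $0$ otherwise. The algebraic normal form of a Boolean function is its unique representation as a sum over $\mathbf Z/2\mathbf Z$ of distinct squarefree monomials in the variables. *)

theory Defs
  imports Main "HOL-Library.Z2" "HOL-Library.FuncSet"
begin

text \<open>
  Boolean functions of the variables \<open>x 0, \<dots>, x (w - 1)\<close> take values in the field \<^typ>\<open>bit\<close> of two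
  elements; only their values on the \<open>2 ^ w\<close> assignments \<open>{..<w} \<rightarrow>\<^sub>E UNIV\<close> are relevant.
  A squarefree monomial is identified with the set of indices of its variables, and a sum of
  distinct squarefree monomials with the set of its monomials.
\<close>

definition eval_monomial :: "nat set \<Rightarrow> (nat \<Rightarrow> bit) \<Rightarrow> bit" where
  "eval_monomial S x = (\<Prod>i\<in>S. x i)"

definition is_anf :: "nat \<Rightarrow> ((nat \<Rightarrow> bit) \<Rightarrow> bit) \<Rightarrow> nat set set \<Rightarrow> bool" where
  "is_anf w f A \<longleftrightarrow>
     A \<subseteq> Pow {..<w} \<and> (\<forall>x \<in> {..<w} \<rightarrow>\<^sub>E UNIV. f x = (\<Sum>S\<in>A. eval_monomial S x))"

definition anf :: "nat \<Rightarrow> ((nat \<Rightarrow> bit) \<Rightarrow> bit) \<Rightarrow> nat set set" where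
  "anf w f = (THE A. is_anf w f A)"

definition word_of_bits :: "nat \<Rightarrow> (nat \<Rightarrow> bit) \<Rightarrow> nat" where
  "word_of_bits w x = (\<Sum>i<w. of_bool (x i = 1) * 2 ^ i)"

definition triple_bit :: "nat \<Rightarrow> nat \<Rightarrow> (nat \<Rightarrow> bit) \<Rightarrow> bit" where
  "triple_bit w b x = of_bool (bit ((3 * word_of_bits w x) mod 2 ^ w) b)"


text \<open>Existence and uniqueness of the algebraic normal form, so that \<^const>\<open>anf\<close> is well defined.\<close>

lemma is_anf_inj:
  assumes "A \<subseteq> Pow {..<w}" "B \<subseteq> Pow {..<w}"
    and eq: "\<And>x. x \<in> {..<w} \<rightarrow>\<^sub>E UNIV \<Longrightarrow>
      (\<Sum>S\<in>A. eval_monomial S x) = (\<Sum>S\<in>B. eval_monomial S x)"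
  shows "A = B"
proof (rule ccontr)
  assume "A \<noteq> B"
  define D where "D = (A - B) \<union> (B - A)"
  have "D \<noteq> {}" using \<open>A \<noteq> B\<close> by (auto simp: D_def)
  have fin: "finite A" "finite B"
    using assms(1,2) by (auto intro: finite_subset)
  then have "finite D" by (simp add: D_def)
  then obtain S where S: "S \<in> D" "\<And>T. T \<in> D \<Longrightarrow> T \<subseteq> S \<Longrightarrow> T = S"
    using \<open>D \<noteq> {}\<close> finite_has_minimal[of D] by metis
  have Sw: "S \<subseteq> {..<w}" using S(1) assms(1,2) by (auto simp: D_def)
  define x :: "nat \<Rightarrow> bit" where "x = (\<lambda>i\<in>{..<w}. of_bool (i \<in> S))"
  have x: "x \<in> {..<w} \<rightarrow>\<^sub>E UNIV" by (auto simp: x_def)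
  have ev: "eval_monomial T x = of_bool (T \<subseteq> S)" if "T \<subseteq> {..<w}" for T
  proof -
    have "finite T" using that by (rule finite_subset) simp
    show ?thesis
    proof (cases "T \<subseteq> S")
      case True
      then have "x i = 1" if "i \<in> T" for i
        using that \<open>T \<subseteq> {..<w}\<close> by (auto simp: x_def)
      then show ?thesis using True by (simp add: eval_monomial_def)
    next
      case False
      then obtain i where i: "i \<in> T" "i \<notin> S" by auto
      then have "x i = 0" using that by (auto simp: x_def)
      then have "(\<Prod>i\<in>T. x i) = 0" using i(1) \<open>finite T\<close> by (intro prod_zero) auto
      then show ?thesis using False by (simp add: eval_monomial_def)
    qed
  qed
  have split: "(\<Sum>T\<in>C. eval_monomial T x) =
      of_bool (S \<in> C) + (\<Sum>T\<in>{T \<in> C. T \<subset> S}. 1)"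
    if "C \<subseteq> Pow {..<w}" for C
  proof -
    have finC: "finite C" using that by (rule finite_subset) simp
    have "(\<Sum>T\<in>C. eval_monomial T x) = (\<Sum>T\<in>C. of_bool (T \<subseteq> S))"
      using that by (intro sum.cong refl ev) blast
    also have "\<dots> = (\<Sum>T\<in>C. (if T = S then 1 else 0) + (if T \<subset> S then 1 else 0))"
      by (intro sum.cong) auto
    also have "\<dots> = of_bool (S \<in> C) + (\<Sum>T\<in>{T \<in> C. T \<subset> S}. 1)"
      by (simp only: sum.distrib sum.delta[OF finC] sum.inter_filter[OF finC] of_bool_def)
    finally show ?thesis .
  qed
  have "{T \<in> A. T \<subset> S} = {T \<in> B. T \<subset> S}"
    using S(2) by (auto simp: D_def)
  then have "(of_bool (S \<in> A) :: bit) = of_bool (S \<in> B)"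
    using eq[OF x] split[OF assms(1)] split[OF assms(2)] by (metis add_right_cancel)
  then have "S \<in> A \<longleftrightarrow> S \<in> B" by (auto split: if_splits simp: of_bool_def)
  with S(1) show False by (auto simp: D_def)
qed

lemma ex1_is_anf: "\<exists>!A. is_anf w f A"
proof -
  define X where "X = ({..<w} \<rightarrow>\<^sub>E (UNIV :: bit set))"
  define Q where "Q = X \<rightarrow>\<^sub>E (UNIV :: bit set)"
  define h where "h = (\<lambda>A. \<lambda>x\<in>X. \<Sum>S\<in>A. eval_monomial S x)"
  have U: "(UNIV :: bit set) = {0, 1}"
    using bit_not_zero_iff by auto
  have finU: "finite (UNIV :: bit set)" and cU: "card (UNIV :: bit set) = 2"
    unfolding U by auto
  have finX: "finite X" and cX: "card X = 2 ^ w"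
    using finU by (auto simp: X_def card_PiE cU intro!: finite_PiE)
  have finQ: "finite Q" and cQ: "card Q = 2 ^ (2 ^ w)"
    using finX finU by (auto simp: Q_def card_PiE cU cX intro!: finite_PiE)
  have inj: "inj_on h (Pow (Pow {..<w}))"
  proof (rule inj_onI)
    fix A B assume AB: "A \<in> Pow (Pow {..<w})" "B \<in> Pow (Pow {..<w})" "h A = h B"
    show "A = B"
    proof (rule is_anf_inj[of A w B])
      fix x assume "x \<in> {..<w} \<rightarrow>\<^sub>E (UNIV :: bit set)"
      then have "x \<in> X" by (simp add: X_def)
      with fun_cong[OF AB(3), of x]
      show "(\<Sum>S\<in>A. eval_monomial S x) = (\<Sum>S\<in>B. eval_monomial S x)"
        by (simp add: h_def)
    qed (use AB in auto)
  qed
  have "h ` Pow (Pow {..<w}) = Q"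
  proof (rule card_subset_eq[OF finQ])
    show "h ` Pow (Pow {..<w}) \<subseteq> Q" by (auto simp: h_def Q_def)
    show "card (h ` Pow (Pow {..<w})) = card Q"
      by (simp add: card_image[OF inj] card_Pow cQ)
  qed
  moreover have "restrict f X \<in> Q" by (auto simp: Q_def)
  ultimately obtain A where A: "A \<in> Pow (Pow {..<w})" "restrict f X = h A" by blast
  have "is_anf w f A"
    unfolding is_anf_def
  proof (intro conjI ballI)
    fix x assume "x \<in> {..<w} \<rightarrow>\<^sub>E (UNIV :: bit set)"
    then have "x \<in> X" by (simp add: X_def)
    with fun_cong[OF A(2), of x] show "f x = (\<Sum>S\<in>A. eval_monomial S x)"
      by (simp add: h_def)
  qed (use A in auto)
  moreover have "B = A" if "is_anf w f B" for B
    using that \<open>is_anf w f A\<close> unfolding is_anf_def by (intro is_anf_inj[of B w A]) auto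
  ultimately show ?thesis by blast
qed

lemma is_anf_anf: "is_anf w f (anf w f)"
  unfolding anf_def by (rule theI'[OF ex1_is_anf])

end

theory Submission imports Defs begin

text \<open>
  Write \<open>3x = x + 2x\<close> and let \<open>c n\<close> be the carry into position \<open>n + 1\<close>, so that
  \<open>z (n + 1) = x (n + 1) + x n + c n\<close> and \<open>c (n + 1)\<close> is the majority of \<open>x (n + 1)\<close>, \<open>x n\<close>, \<open>c n\<close>, i.e.
  \<open>c (n + 1) = x (n + 1) * (x n + c n) + r n\<close> with \<open>r n = x n * c n\<close>. Eliminating the carry from \<open>r\<close>
  gives \<open>r (n + 2) = x (n + 2) * (x (n + 1) + r n + x (n + 1) * r n)\<close>. No cancellation occurs in
  these two recurrences, so they translate into recurrences for the numbers of monomials.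
\<close>

section \<open>The carry and explicit sets of monomials\<close>

fun carry :: "(nat \<Rightarrow> bit) \<Rightarrow> nat \<Rightarrow> bit" where
  "carry x 0 = 0"
| "carry x (Suc n) = x (Suc n) * (x n + carry x n) + x n * carry x n"

text \<open>Intended as the normal form of \<open>x n * carry x n\<close>. Eliminating the carry
  links positions two apart, hence the two base cases; the second is
  \<open>x 1 * carry x 1 = x 0 * x 1\<close>.\<close>

fun propagated_monomials :: "nat \<Rightarrow> nat set set" where
  "propagated_monomials 0 = {}"
| "propagated_monomials (Suc 0) = {{0, 1}}"
| "propagated_monomials (Suc (Suc n)) =
     insert (Suc (Suc n)) ` insert {Suc n} (propagated_monomials n \<union> insert (Suc n) ` propagated_monomials n)"

fun carry_monomials :: "nat \<Rightarrow> nat set set" where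
  "carry_monomials 0 = {}"
| "carry_monomials (Suc n) =
     insert (Suc n) ` insert {n} (carry_monomials n) \<union> propagated_monomials n"

fun triple_monomials :: "nat \<Rightarrow> nat set set" where
  "triple_monomials 0 = {{0}}"
| "triple_monomials (Suc n) = insert {Suc n} (insert {n} (carry_monomials n))"

text \<open>The bound makes each variable multiplied in later a fresh one; without the constant
  monomial, such a product never yields a single variable.\<close>

lemma propagated_monomials_subset: "propagated_monomials n \<subseteq> Pow {..n} - {{}}"
proof (induction n rule: propagated_monomials.induct)
  case (3 n)
  then have "S \<subseteq> {..Suc (Suc n)}" if "S \<in> propagated_monomials n" for S
    using that by fastforce
  then show ?case by auto
qed auto

lemma carry_monomials_subset: "carry_monomials n \<subseteq> Pow {..n} - {{}}"
proof (induction n)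
  case (Suc n)
  have "S \<subseteq> {..Suc n}" "S \<noteq> {}" if "S \<in> carry_monomials n \<union> propagated_monomials n" for S
    using that Suc propagated_monomials_subset[of n] by fastforce+
  then show ?case by auto
qed simp

text \<open>In the carry, the top variable occurs only multiplied by a nonempty monomial in lower
  variables. Hence \<open>x n + carry x n\<close> has no cancellation.\<close>

lemma singleton_notin_carry_monomials: "{n} \<notin> carry_monomials n"
proof (cases n)
  case (Suc m)
  have "{Suc m} \<noteq> insert (Suc m) S" if "S \<in> insert {m} (carry_monomials m)" for S
  proof
    assume "{Suc m} = insert (Suc m) S"
    with that carry_monomials_subset[of m] have "Suc m \<in> S" "S \<subseteq> {..m}" by auto
    then show False by auto
  qed
  moreover have "{Suc m} \<notin> propagated_monomials m"
    using propagated_monomials_subset[of m] by auto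
  ultimately show ?thesis using Suc by auto
qed simp

lemma inj_on_insert_Pow: "A \<subseteq> Pow B \<Longrightarrow> a \<notin> B \<Longrightarrow> inj_on (insert a) A"
  by (rule inj_onI) (metis PowD insert_ident subsetD)

lemma finite_propagated_monomials: "finite (propagated_monomials n)"
  using propagated_monomials_subset[of n] by (auto intro: finite_subset)

lemma finite_carry_monomials: "finite (carry_monomials n)"
  using carry_monomials_subset[of n] by (auto intro: finite_subset)

section \<open>Evaluation without cancellation\<close>

lemma eval_monomial_insert:
  "S \<subseteq> {..<n} \<Longrightarrow> eval_monomial (insert n S) x = x n * eval_monomial S x"
  unfolding eval_monomial_def by (subst prod.insert) (auto intro: finite_subset)

lemma eval_monomial_singleton: "eval_monomial {i} x = x i"
  by (simp add: eval_monomial_def)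

lemma sum_eval_monomial_insert:
  assumes "A \<subseteq> Pow {..<n}"
  shows "(\<Sum>S\<in>insert n ` A. eval_monomial S x) = x n * (\<Sum>S\<in>A. eval_monomial S x)"
proof -
  have "inj_on (insert n) A"
    using assms by (rule inj_on_insert_Pow) simp
  then have "(\<Sum>S\<in>insert n ` A. eval_monomial S x) = (\<Sum>S\<in>A. eval_monomial (insert n S) x)"
    by (simp only: sum.reindex o_def)
  also have "\<dots> = (\<Sum>S\<in>A. x n * eval_monomial S x)"
    using assms by (intro sum.cong refl eval_monomial_insert) auto
  finally show ?thesis
    by (simp only: sum_distrib_left)
qed

text \<open>The variable \<open>Suc n\<close> separates the summands: it is absent from
  \<open>propagated_monomials n\<close>, and its products with those nonempty monomials have at
  least two variables.\<close>

lemma propagated_monomials_disjoint: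
  "{Suc n} \<notin> propagated_monomials n \<union> insert (Suc n) ` propagated_monomials n"
  "propagated_monomials n \<inter> insert (Suc n) ` propagated_monomials n = {}"
proof -
  have R: "S \<noteq> {}" "Suc n \<notin> S" if "S \<in> propagated_monomials n" for S
    using that propagated_monomials_subset[of n] by fastforce+
  then show "{Suc n} \<notin> propagated_monomials n \<union> insert (Suc n) ` propagated_monomials n"
    by blast
  show "propagated_monomials n \<inter> insert (Suc n) ` propagated_monomials n = {}"
    using R by blast
qed

lemma carry_monomials_disjoint:
  "insert (Suc n) ` insert {n} (carry_monomials n) \<inter> propagated_monomials n = {}"
  using propagated_monomials_subset[of n] by fastforce

lemma eval_propagated_monomials:
  "(\<Sum>S\<in>propagated_monomials n. eval_monomial S x) = x n * carry x n"
proof (induction n rule: propagated_monomials.induct)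
  case 2
  show ?case by (cases "x 0"; cases "x 1") (simp_all add: eval_monomial_def)
next
  case (3 n)
  let ?R = "propagated_monomials n" and ?e = "\<lambda>S. eval_monomial S x"
  have R: "?R \<subseteq> Pow {..<Suc n}"
    using propagated_monomials_subset[of n] by (auto simp: lessThan_Suc_atMost)
  have "insert {Suc n} (?R \<union> insert (Suc n) ` ?R) \<subseteq> Pow {..<Suc (Suc n)}"
    using R by force
  then have "sum ?e (propagated_monomials (Suc (Suc n))) =
      x (Suc (Suc n)) * sum ?e (insert {Suc n} (?R \<union> insert (Suc n) ` ?R))"
    unfolding propagated_monomials.simps by (rule sum_eval_monomial_insert)
  also have "sum ?e (insert {Suc n} (?R \<union> insert (Suc n) ` ?R)) =
      x (Suc n) + (sum ?e ?R + x (Suc n) * sum ?e ?R)"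
    using propagated_monomials_disjoint[of n]
    by (simp only: sum.insert sum.union_disjoint sum_eval_monomial_insert[OF R]
        finite_propagated_monomials finite_imageI finite_UnI eval_monomial_singleton not_False_eq_True)
  \<comment> \<open>After the induction hypothesis this is a polynomial identity in four bits,
    relying on idempotence; it is checked on all their values.\<close>
  also have "x (Suc (Suc n)) * \<dots> = x (Suc (Suc n)) * carry x (Suc (Suc n))"
    unfolding 3
    by (cases "x n"; cases "x (Suc n)"; cases "x (Suc (Suc n))"; cases "carry x n") simp_all
  finally show ?case .
qed simp

lemma eval_carry_monomials:
  "(\<Sum>S\<in>carry_monomials n. eval_monomial S x) = carry x n"
proof (induction n)
  case (Suc n)
  have "insert {n} (carry_monomials n) \<subseteq> Pow {..<Suc n}"
    using carry_monomials_subset[of n] by (auto simp: lessThan_Suc_atMost)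
  note this[THEN sum_eval_monomial_insert]
  then show ?case
    using Suc carry_monomials_disjoint[of n] singleton_notin_carry_monomials[of n]
    by (simp only: carry_monomials.simps carry.simps sum.union_disjoint sum.insert
        finite_carry_monomials finite_propagated_monomials finite_imageI finite_insert
        eval_propagated_monomials eval_monomial_singleton not_False_eq_True)
qed simp

section \<open>Counting monomials\<close>

text \<open>The count \<open>a\<close> satisfies \<open>a (n + 2) = 2 * a n + 1\<close>, so
  \<open>a + 1\<close> doubles every two steps.\<close>

lemma card_propagated_monomials: "Suc (card (propagated_monomials n)) = 2 ^ (Suc n div 2)"
proof (induction n rule: propagated_monomials.induct)
  case (3 n)
  let ?R = "propagated_monomials n"
  have R: "?R \<subseteq> Pow {..n}"
    using propagated_monomials_subset by auto
  then have "insert {Suc n} (?R \<union> insert (Suc n) ` ?R) \<subseteq> Pow {..Suc n}"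
    by force
  then have "inj_on (insert (Suc (Suc n))) (insert {Suc n} (?R \<union> insert (Suc n) ` ?R))"
    by (rule inj_on_insert_Pow) simp
  then have "card (propagated_monomials (Suc (Suc n))) = Suc (card ?R + card (insert (Suc n) ` ?R))"
    using propagated_monomials_disjoint[of n] unfolding propagated_monomials.simps
    by (simp add: card_image finite_propagated_monomials card_Un_disjoint del: image_insert)
  also have "card (insert (Suc n) ` ?R) = card ?R"
    using R by (intro card_image inj_on_insert_Pow) auto
  finally show ?case using 3 by simp
qed simp_all

lemma card_carry_monomials_Suc:
  "card (carry_monomials (Suc n)) = card (carry_monomials n) + 2 ^ (Suc n div 2)"
proof -
  have "inj_on (insert (Suc n)) (insert {n} (carry_monomials n))"
    using carry_monomials_subset[of n] by (intro inj_on_insert_Pow[where B = "{..n}"]) auto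
  then have "card (carry_monomials (Suc n)) =
      Suc (card (carry_monomials n)) + card (propagated_monomials n)"
    using carry_monomials_disjoint[of n] singleton_notin_carry_monomials[of n]
    unfolding carry_monomials.simps
    by (simp add: card_Un_disjoint card_image finite_carry_monomials finite_propagated_monomials
        del: image_insert)
  then show ?thesis
    using card_propagated_monomials[of n] by simp
qed

text \<open>With the shift by 3, the increment \<open>2 ^ k\<close> alternately turns
  \<open>3 * 2 ^ k\<close> into \<open>2 * 2 ^ (k + 1)\<close> and \<open>2 * 2 ^ k\<close> into
  \<open>3 * 2 ^ k\<close>.\<close>

lemma card_carry_monomials:
  "card (carry_monomials n) + 3 = (2 + of_bool (even n)) * 2 ^ (Suc n div 2)"
proof (induction n)
  case (Suc n)
  show ?case
    using Suc unfolding card_carry_monomials_Suc by (cases "even n") (auto elim!: evenE oddE)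
qed simp

lemma singleton_Suc_notin_carry_monomials: "{Suc n} \<notin> insert {n} (carry_monomials n)"
  using carry_monomials_subset[of n] by auto

lemma card_triple_monomials:
  "card (triple_monomials b) = (2 + of_bool (odd b)) * 2 ^ (b div 2) - 1"
proof (cases b)
  case (Suc n)
  \<comment> \<open>The two single variables add 2 to the carry count, so its offset 3 becomes 1;
    passing from \<open>n\<close> to \<open>Suc n\<close> flips the parity.\<close>
  then show ?thesis
    using card_carry_monomials[of n] singleton_Suc_notin_carry_monomials[of n]
      singleton_notin_carry_monomials[of n]
    by (simp add: finite_carry_monomials)
qed simp

lemma triple_monomials_subset: "triple_monomials b \<subseteq> Pow {..b}"
proof (cases b)
  case (Suc n)
  then show ?thesis
    using carry_monomials_subset[of n] by fastforce
qed simp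

section \<open>Binary arithmetic of 3x\<close>

lemma word_of_bits_Suc: "word_of_bits (Suc n) x = word_of_bits n x + of_bool (x n = 1) * 2 ^ n"
  by (simp add: word_of_bits_def)

lemma word_of_bits_split: "k \<le> w \<Longrightarrow> \<exists>m. word_of_bits w x = word_of_bits k x + 2 ^ k * m"
proof (induction w rule: dec_induct)
  case (step n)
  then obtain m where "word_of_bits n x = word_of_bits k x + 2 ^ k * m" by blast
  then have "word_of_bits (Suc n) x =
      word_of_bits k x + 2 ^ k * (m + of_bool (x n = 1) * 2 ^ (n - k))"
    using step.hyps by (simp add: word_of_bits_Suc algebra_simps flip: power_add)
  then show ?case by blast
qed auto

text \<open>The two summands are the parts of x and 2x in positions 0 to n, so the quotient is what
  overflows into position n + 1.\<close>

lemma carry_word_of_bits: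
  "(word_of_bits (Suc n) x + 2 * word_of_bits n x) div 2 ^ Suc n = of_bool (carry x n = 1)"
proof (induction n)
  case 0
  then show ?case by (simp add: word_of_bits_def)
next
  case (Suc n)
  let ?a = "of_bool (x n = 1) :: nat" and ?b = "of_bool (x (Suc n) = 1) :: nat"
  have "word_of_bits (Suc (Suc n)) x + 2 * word_of_bits (Suc n) x =
      (word_of_bits (Suc n) x + 2 * word_of_bits n x) + (?a + ?b) * 2 ^ Suc n"
    by (simp add: word_of_bits_Suc algebra_simps)
  then have "(word_of_bits (Suc (Suc n)) x + 2 * word_of_bits (Suc n) x) div 2 ^ Suc n =
      (?a + ?b) + of_bool (carry x n = 1)"
    using Suc by (simp only: div_mult_self1 power_not_zero zero_neq_numeral[symmetric] not_False_eq_True)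
  \<comment> \<open>Halving a sum of three bits gives their majority, which is the recursion of
    \<open>carry\<close>.\<close>
  then have "(word_of_bits (Suc (Suc n)) x + 2 * word_of_bits (Suc n) x) div 2 ^ Suc n div 2 =
      of_bool (carry x (Suc n) = 1)"
    by (cases "x n"; cases "x (Suc n)"; cases "carry x n") simp_all
  then show ?case by (simp only: div_mult2_eq power_Suc2)
qed

lemma triple_bit_0: "0 < w \<Longrightarrow> triple_bit w 0 x = x 0"
  using word_of_bits_split[of 1 w x]
  by (cases "x 0") (auto simp: triple_bit_def bit_take_bit_iff bit_0 word_of_bits_def
      simp flip: take_bit_eq_mod)

lemma triple_bit_Suc:
  assumes "Suc n < w"
  shows "triple_bit w (Suc n) x = x (Suc n) + x n + carry x n"
proof -
  let ?a = "of_bool (x n = 1) :: nat" and ?b = "of_bool (x (Suc n) = 1) :: nat"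
  obtain m where m: "word_of_bits w x = word_of_bits (Suc (Suc n)) x + 2 ^ Suc (Suc n) * m"
    using word_of_bits_split[of "Suc (Suc n)" w x] assms by auto
  \<comment> \<open>At weight \<open>2 ^ Suc n\<close>, x contributes \<open>?b\<close> and 2x
    contributes \<open>?a\<close>. The remaining terms have an even coefficient and do not affect
    bit \<open>Suc n\<close>.\<close>
  have "3 * word_of_bits w x = (word_of_bits (Suc n) x + 2 * word_of_bits n x) +
      (?a + ?b + 2 * (?b + 3 * m)) * 2 ^ Suc n"
    unfolding m by (simp add: word_of_bits_Suc algebra_simps)
  then have "3 * word_of_bits w x div 2 ^ Suc n =
      of_bool (carry x n = 1) + (?a + ?b + 2 * (?b + 3 * m))"
    using carry_word_of_bits[of n x] by simp
  then have "bit (3 * word_of_bits w x) (Suc n) \<longleftrightarrow> odd (of_bool (carry x n = 1) + ?a + ?b)"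
    by (simp add: bit_iff_odd del: power_Suc)
  then show ?thesis
    using assms by (cases "x n"; cases "x (Suc n)"; cases "carry x n")
      (simp_all add: triple_bit_def bit_take_bit_iff flip: take_bit_eq_mod)
qed

lemma eval_triple_monomials:
  assumes "b < w"
  shows "(\<Sum>S\<in>triple_monomials b. eval_monomial S x) = triple_bit w b x"
proof (cases b)
  case 0
  then show ?thesis using assms by (simp add: triple_bit_0 eval_monomial_def)
next
  case (Suc n)
  have "(\<Sum>S\<in>triple_monomials (Suc n). eval_monomial S x) = x (Suc n) + (x n + carry x n)"
    using singleton_Suc_notin_carry_monomials[of n] singleton_notin_carry_monomials[of n]
    by (simp only: triple_monomials.simps sum.insert finite_carry_monomials finite_insert
        eval_carry_monomials eval_monomial_singleton not_False_eq_True)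
  then show ?thesis
    using Suc assms by (simp only: triple_bit_Suc add.assoc)
qed

theorem theorem10p4:
  fixes w b :: nat
  assumes "w \<ge> 1" and "b < w"
  shows "card (anf w (triple_bit w b)) = (2 + of_bool (odd b)) * 2 ^ (b div 2) - 1"
proof -
  have "triple_monomials b \<subseteq> Pow {..<w}"
    using triple_monomials_subset[of b] assms(2) by fastforce
  then have "is_anf w (triple_bit w b) (triple_monomials b)"
    using assms(2) by (simp add: is_anf_def eval_triple_monomials)
  then have "anf w (triple_bit w b) = triple_monomials b"
    using ex1_is_anf is_anf_anf by blast
  then show ?thesis by (simp add: card_triple_monomials)
qed

end
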